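(* Let $p>1$, $d\geq 2$, let $u\in C_c^2(\mathbb{R}^d\setminus\{0\})$ be antisymmetric, and let $\gamma\in\mathbb{R}$ be such that $$ N:=(\gamma+2p-2)\left(2(p-1)d(d-1)+p(d-\gamma-2p)\right)+(p-1)\left(d^2-\gamma-2p\right)^2\geq 0 . $$ Then $$ \int_{\mathbb{R}^d}\frac{|\Delta u(x)|^p}{|x|^{\gamma}}\,dx\geq C_R(d,p,\gamma)\int_{\mathbb{R}^d}\frac{|u(x)|^p}{|x|^{\gamma+2p}}\,dx, \qquad\text{where}\qquad C_R(d,p,\gamma)=\left(\frac{N}{p^2}\right)^p. $$
   Context: A function $u$ is antisymmetric if $u(x_1,\dots,x_i,\dots,x_j,\dots,x_d)=-u(x_1,\dots,x_j,\dots,x_i,\dots,x_d)$ for all $1\leq i\neq j\leq d$ (i.e. it changes sign when any two coordinates are swapped). $C^2_c(\mathbb{R}^d\setminus\{0\})$ is the space of $C^2$ functions with compact support contained in $\mathbb{R}^d\setminus\{0\}$. $\Delta$ is the Laplacian and $|\cdot|$ the Euclidean norm. *)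

theory Defs
  imports "HOL-Analysis.Analysis"
begin

(* Meaningful only where f is differentiable (frechet_derivative is a choice
   operator); Ck_on below guarantees this wherever it is used. *)
definition partial :: "'n \<Rightarrow> (real^'n \<Rightarrow> real) \<Rightarrow> real^'n \<Rightarrow> real" where
  "partial i f x = frechet_derivative f (at x) (axis i 1)"

definition laplacian :: "(real^'n \<Rightarrow> real) \<Rightarrow> real^'n \<Rightarrow> real" where
  "laplacian f x = (\<Sum>i\<in>UNIV. partial i (partial i f) x)"

(* f is k times continuously differentiable on S; intended for open S, where
   differentiable_on agrees with differentiability at every point of S. *)
primrec Ck_on :: "nat \<Rightarrow> (real^'n) set \<Rightarrow> (real^'n \<Rightarrow> real) \<Rightarrow> bool" where
  "Ck_on 0 S f \<longleftrightarrow> continuous_on S f"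
| "Ck_on (Suc k) S f \<longleftrightarrow> f differentiable_on S \<and> (\<forall>i. Ck_on k S (partial i f))"

(* C^k functions with compact support contained in the open set S, represented
   by their extension by zero; the closure is taken in the whole space, so the
   support stays away from the boundary of S. *)
definition Ck_compact :: "nat \<Rightarrow> (real^'n) set \<Rightarrow> (real^'n \<Rightarrow> real) set" where
  "Ck_compact k S = {f. Ck_on k S f \<and> compact (closure {x. f x \<noteq> 0}) \<and> closure {x. f x \<noteq> 0} \<subseteq> S}"

(* The qualified name avoids the clash with matrix transposition. *)
definition swap_coords :: "'n \<Rightarrow> 'n \<Rightarrow> real^'n \<Rightarrow> real^'n" where
  "swap_coords i j x = (\<chi> k. x $ Transposition.transpose i j k)"

definition antisymmetric :: "(real^'n \<Rightarrow> real) \<Rightarrow> bool" where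
  "antisymmetric f \<longleftrightarrow> (\<forall>i j x. i \<noteq> j \<longrightarrow> f x = - f (swap_coords i j x))"

definition rellich_N :: "real \<Rightarrow> real \<Rightarrow> real \<Rightarrow> real" where
  "rellich_N d p \<gamma> =
     (\<gamma> + 2*p - 2) * (2*(p - 1)*d*(d - 1) + p*(d - \<gamma> - 2*p)) + (p - 1)*(d^2 - \<gamma> - 2*p)^2"

definition rellich_const :: "real \<Rightarrow> real \<Rightarrow> real \<Rightarrow> real" where
  "rellich_const d p \<gamma> = (rellich_N d p \<gamma> / p^2) powr p"

end

theory Submission
  imports Defs
begin

text \<open>
  Write \<open>d\<close> for the dimension, \<open>r = |x|\<close>, \<open>a = \<gamma> + 2p - 2\<close> and \<open>c = N / p^2\<close>. The heart of the proof is the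
  estimate
    \<open>- \<integral> \<Delta>u |u|^(p-2) u r^(-a) \<ge> c \<integral> |u|^p r^(-a-2)\<close>,
  from which Young's inequality gives \<open>\<integral> |\<Delta>u|^p r^(-\<gamma>) \<ge> c^p \<integral> |u|^p r^(-\<gamma>-2p)\<close>.

  Integrating by parts, the left-hand side of the estimate is
  \<open>(p-1) \<integral> |u|^(p-2) |\<nabla>u|^2 r^(-a)\<close> plus a multiple of the right-hand side, so a Hardy inequality for
  antisymmetric functions is needed. Antisymmetry makes \<open>u\<close> vanish on the hyperplanes \<open>x_i = x_j\<close>, and
  on their complement there is the positive function \<open>\<phi> = r^s |V|\<close> with \<open>V\<close> the Vandermonde product,
  which is harmonic and homogeneous of degree \<open>k = d(d-1)/2\<close>. Expanding
  \<open>|\<nabla>v - v B|^2 \<ge> 0\<close> for \<open>v = |u|^(p/2)\<close> with \<open>B = \<nabla>\<phi> / \<phi> = s x / r^2 + A\<close>,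
  \<open>A = \<nabla>V / V\<close>, yields a Hardy inequality, whose constant is largest for the exponent
  \<open>s = - (d^2 - 2 - a) / 2\<close>. Only two facts about \<open>A\<close> enter:
  Euler's identity \<open>x \<bullet> A = k\<close> (\<open>inner_repulsion\<close>) and \<open>|A|^2 = - div A\<close>, which expresses that \<open>V\<close> is
  harmonic (\<open>sum_repulsion_squared\<close>).

  All these steps are carried out at once: for the single flux
    \<open>F = r^(-a) (|u|^p E - |u|^(p-2) u \<nabla>u)\<close>, where \<open>p E = p \<beta> B - a x / r^2\<close> and \<open>\<beta> = 4(p-1)/p^2\<close>,
  the pointwise inequality \<open>div F + c |u|^p r^(-a-2) \<le> - \<Delta>u |u|^(p-2) u r^(-a)\<close> holds
  (\<open>divergence_bound\<close>), and the integral of \<open>div F\<close> vanishes. To make \<open>F\<close> continuously differentiable,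
  \<open>|u|^p\<close> is replaced by \<open>\<omega>(u)^p\<close> for an even convex function \<open>\<omega>\<close> that is zero on \<open>[-\<epsilon>, \<epsilon>]\<close> and satisfies
  \<open>|\<omega>'| \<le> 1\<close>; correspondingly \<open>|u|^(p-2) u\<close> becomes \<open>\<omega>(u)^(p-1) \<omega>'(u)\<close>. Convexity keeps the sign of the
  gradient terms, the bound on \<open>\<omega>'\<close> is what Young's inequality needs, and the support of \<open>\<omega>(u)\<close> is a
  compact set that avoids the origin and all the hyperplanes. Finally \<open>\<epsilon>\<close> tends to zero by dominated
  convergence.
\<close>

section \<open>Integrals of directional derivatives\<close>

lemma compact_support_integrable:
  fixes G :: "'a::euclidean_space \<Rightarrow> real"
  assumes "compact K" and "continuous_on UNIV G" and "\<And>x. x \<notin> K \<Longrightarrow> G x = 0"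
  shows "integrable lborel G"
proof -
  have "integrable lborel (\<lambda>x. indicator K x *\<^sub>R G x)"
    by (rule borel_integrable_compact[OF assms(1)]) (rule continuous_on_subset[OF assms(2)], simp)
  also have "(\<lambda>x. indicator K x *\<^sub>R G x) = G"
    using assms(3) by (auto simp: indicator_def fun_eq_iff)
  finally show ?thesis .
qed

text \<open>
  The difference quotients of \<open>F\<close> along \<open>e\<close> have integral zero by translation invariance of Lebesgue
  measure; by the mean value theorem they are bounded by the maximum of \<open>|G|\<close>, so dominated convergence
  applies.
\<close>

lemma integral_directional_derivative_eq_0:
  fixes F G :: "'a::euclidean_space \<Rightarrow> real"
  assumes K: "compact K" and F0: "\<And>x. x \<notin> K \<Longrightarrow> F x = 0"
    and G0: "\<And>x. x \<notin> K \<Longrightarrow> G x = 0"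
    and F: "continuous_on UNIV F" and G: "continuous_on UNIV G"
    and der: "\<And>x. ((\<lambda>t. F (x + t *\<^sub>R e)) has_real_derivative G x) (at 0)"
  shows "integral\<^sup>L lborel G = 0"
proof -
  have intF: "integrable lborel F" using compact_support_integrable[OF K F F0] .
  have "bounded (G ` K)"
    by (intro compact_imp_bounded compact_continuous_image K continuous_on_subset[OF G]) auto
  then obtain M0 where M0: "\<And>x. x \<in> K \<Longrightarrow> \<bar>G x\<bar> \<le> M0"
    by (auto simp: bounded_iff)
  define M where "M = max M0 0"
  have M: "\<bar>G x\<bar> \<le> M" "M \<ge> 0" for x
    using M0[of x] G0[of x] by (cases "x \<in> K", auto simp: M_def)
  obtain R where R: "\<And>x. x \<in> K \<Longrightarrow> norm x \<le> R"
    using compact_imp_bounded[OF K] by (auto simp: bounded_iff)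
  have der': "((\<lambda>t. F (x + t *\<^sub>R e)) has_real_derivative G (x + s *\<^sub>R e)) (at s)" for x s
    using der[of "x + s *\<^sub>R e"] DERIV_at_within_shift[of "\<lambda>t. F (x + t *\<^sub>R e)" "G (x + s *\<^sub>R e)" s 0 UNIV]
    by (simp add: algebra_simps)
  have lip: "\<bar>F (x + t *\<^sub>R e) - F x\<bar> \<le> M * \<bar>t\<bar>" for x t
    using field_differentiable_bound[of UNIV "\<lambda>t. F (x + t *\<^sub>R e)" "\<lambda>s. G (x + s *\<^sub>R e)" M t 0]
      der' M by auto
  define \<tau> where "\<tau> n = inverse (real (Suc n))" for n
  have \<tau>: "\<tau> n > 0" "\<tau> n \<le> 1" for n by (auto simp: \<tau>_def field_simps)
  have \<tau>0: "\<tau> \<longlonglongrightarrow> 0" unfolding \<tau>_def using LIMSEQ_inverse_real_of_nat .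
  define D where "D n x = (F (x + \<tau> n *\<^sub>R e) - F x) / \<tau> n" for n x
  \<comment> \<open>Translates by at most \<open>|e|\<close> of the support stay in this ball.\<close>
  let ?B = "cball (0::'a) (R + norm e)"
  have bound: "norm (D n x) \<le> M * indicator ?B x" for n x
  proof (cases "x \<in> ?B")
    case True
    then show ?thesis using lip[of x "\<tau> n"] \<tau>[of n] by (simp add: D_def field_simps)
  next
    case False
    then have nx: "norm x > R + norm e" by simp
    have "norm x \<le> norm (x + \<tau> n *\<^sub>R e) + \<tau> n * norm e"
      using norm_triangle_ineq4[of "x + \<tau> n *\<^sub>R e" "\<tau> n *\<^sub>R e"] \<tau>[of n] by simp
    moreover have "\<tau> n * norm e \<le> norm e" using \<tau>[of n] by (simp add: mult_left_le_one_le)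
    ultimately have "norm (x + \<tau> n *\<^sub>R e) > R" using nx by linarith
    moreover have "norm x > R" using nx norm_ge_zero[of e] by linarith
    ultimately have "F x = 0" "F (x + \<tau> n *\<^sub>R e) = 0" using R F0 by (meson not_le)+
    then show ?thesis using M by (simp add: D_def)
  qed
  have lim: "(\<lambda>n. D n x) \<longlonglongrightarrow> G x" for x
  proof -
    have "((\<lambda>h. (F (x + h *\<^sub>R e) - F x) / h) \<longlongrightarrow> G x) (at 0)"
      using der[of x] by (simp add: DERIV_def)
    moreover have "filterlim \<tau> (at 0) sequentially"
      using \<tau>0 \<tau> by (auto simp: filterlim_at less_imp_neq[symmetric] intro!: always_eventually dest: less_imp_neq)
    ultimately show ?thesis unfolding D_def by (rule filterlim_compose)
  qed
  have shiftD: "distr lborel borel ((+) (\<tau> n *\<^sub>R e)) = (lborel :: 'a measure)" for n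
    by (rule lborel_distr_plus)
  have mF: "F \<in> borel_measurable borel" using F by (rule borel_measurable_continuous_onI)
  have mS: "(+) (\<tau> n *\<^sub>R e) \<in> measurable lborel borel" for n by simp
  have intS: "integrable lborel (\<lambda>x. F (x + \<tau> n *\<^sub>R e))" for n
    using integrable_distr_eq[OF mS mF, of n] intF by (simp add: shiftD add.commute)
  have eqS: "(\<integral>x. F (x + \<tau> n *\<^sub>R e) \<partial>lborel) = integral\<^sup>L lborel F" for n
    using integral_distr[OF mS mF, of n] by (simp add: shiftD add.commute)
  have D0: "integral\<^sup>L lborel (D n) = 0" for n
    unfolding D_def by (simp add: Bochner_Integration.integral_diff[OF intS intF] eqS)
  have "(\<lambda>n. integral\<^sup>L lborel (D n)) \<longlonglongrightarrow> integral\<^sup>L lborel G"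
  proof (rule integral_dominated_convergence[where w = "\<lambda>x. M * indicator ?B x"])
    show "G \<in> borel_measurable lborel" using G by (simp add: borel_measurable_continuous_onI)
    show "D n \<in> borel_measurable lborel" for n
      unfolding D_def using intS[of n] intF by (intro borel_measurable_divide borel_measurable_diff) auto
    show "integrable lborel (\<lambda>x. M * indicator ?B x)"
      using emeasure_lborel_cball_finite[of "0::'a" "R + norm e"] by (intro integrable_mult_right integrable_real_indicator) (auto simp: less_top)
  qed (use lim bound in auto)
  then show ?thesis by (simp add: D0 LIMSEQ_const_iff)
qed

section \<open>The logarithmic gradient of the Vandermonde product\<close>

text \<open>
  The component \<open>\<partial>_i V / V\<close> for \<open>V(x) = \<Prod> (x_i - x_j)\<close> over pairs \<open>i < j\<close>. The sum includes \<open>j = i\<close>: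
  that summand is \<open>1 / 0 = 0\<close>, which also gives the correct value of its derivative below.
\<close>

definition repulsion :: "'n::finite \<Rightarrow> real^'n \<Rightarrow> real" where
  "repulsion i x = (\<Sum>j\<in>UNIV. 1 / (x $ i - x $ j))"

definition distinct_coords :: "real^'n \<Rightarrow> bool" where
  "distinct_coords x \<longleftrightarrow> (\<forall>i j. i \<noteq> j \<longrightarrow> x $ i \<noteq> x $ j)"

text \<open>
  Euler's identity for the homogeneous polynomial \<open>V\<close> of degree \<open>d(d-1)/2\<close>: adding the summands for
  \<open>(i, j)\<close> and \<open>(j, i)\<close> gives \<open>1\<close> for every ordered pair with \<open>i \<noteq> j\<close>.
\<close>

lemma inner_repulsion:
  fixes x :: "real^'n"
  assumes "distinct_coords x"
  shows "(\<Sum>i\<in>UNIV. x $ i * repulsion i x) = real CARD('n) * (real CARD('n) - 1) / 2"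
proof -
  let ?f = "\<lambda>i j. x $ i * (1 / (x $ i - x $ j))"
  have S: "(\<Sum>i\<in>UNIV. x $ i * repulsion i x) = (\<Sum>i\<in>UNIV. \<Sum>j\<in>UNIV. ?f i j)"
    by (simp add: repulsion_def sum_distrib_left)
  have "2 * (\<Sum>i\<in>UNIV. \<Sum>j\<in>UNIV. ?f i j)
      = (\<Sum>i\<in>UNIV. \<Sum>j\<in>UNIV. ?f i j) + (\<Sum>i\<in>UNIV. \<Sum>j\<in>UNIV. ?f j i)"
    using sum.swap[of ?f UNIV UNIV] by simp
  also have "\<dots> = (\<Sum>i\<in>UNIV. \<Sum>j\<in>UNIV. ?f i j + ?f j i)"
    by (simp only: sum.distrib)
  also have "\<dots> = (\<Sum>i\<in>(UNIV::'n set). \<Sum>j\<in>(UNIV::'n set). 1 - (if i = j then 1 else 0))"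
  proof (intro sum.cong refl)
    fix i j :: 'n
    show "?f i j + ?f j i = 1 - (if i = j then 1 else 0)"
    proof (cases "i = j")
      case False
      then have "x $ i - x $ j \<noteq> 0" using assms by (auto simp: distinct_coords_def)
      moreover have "1 / (x $ j - x $ i) = - (1 / (x $ i - x $ j))"
        by (metis minus_diff_eq minus_divide_right)
      then have "?f i j + ?f j i = (x $ i - x $ j) * (1 / (x $ i - x $ j))"
        by (simp only: left_diff_distrib mult_minus_right)
      ultimately show ?thesis using False by simp
    qed simp
  qed
  also have "\<dots> = real CARD('n) * (real CARD('n) - 1)"
    by (simp add: sum_subtractf)
  finally show ?thesis using S by simp
qed

text \<open>
  Harmonicity of \<open>V\<close>, in the form \<open>|A|^2 = - div A\<close>. In the square of the sum, the products belonging
  to three distinct indices cancel, because their sum over the cyclic rotations of \<open>(i, j, l)\<close> is zero.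
\<close>

lemma sum_repulsion_squared:
  fixes x :: "real^'n"
  assumes "distinct_coords x"
  shows "(\<Sum>i\<in>UNIV. (repulsion i x)\<^sup>2) = (\<Sum>i\<in>UNIV. \<Sum>j\<in>UNIV. 1 / (x $ i - x $ j)\<^sup>2)"
proof -
  let ?g = "\<lambda>i j l. 1 / (x $ i - x $ j) * (1 / (x $ i - x $ l))"
  define c where "c i j l = (if j = l then 0 else ?g i j l)" for i j l
  have cyc: "c i j l + c j l i + c l i j = 0" for i j l
  proof (cases "i \<noteq> j \<and> j \<noteq> l \<and> i \<noteq> l")
    case True
    then have "x $ i - x $ j \<noteq> 0" "x $ j - x $ l \<noteq> 0" "x $ i - x $ l \<noteq> 0"
      "x $ j - x $ i \<noteq> 0" "x $ l - x $ j \<noteq> 0" "x $ l - x $ i \<noteq> 0"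
      using assms by (auto simp: distinct_coords_def)
    with True show ?thesis by (simp add: c_def divide_simps) (simp add: algebra_simps)
  next
    case False
    then show ?thesis by (auto simp: c_def)
  qed
  define C where "C = (\<Sum>i\<in>UNIV. \<Sum>j\<in>UNIV. \<Sum>l\<in>UNIV. c i j l)"
  have rot: "(\<Sum>i\<in>UNIV. \<Sum>j\<in>UNIV. \<Sum>l\<in>UNIV. f l i j) = (\<Sum>i\<in>UNIV. \<Sum>j\<in>UNIV. \<Sum>l\<in>UNIV. f i j l)"
    for f :: "'n \<Rightarrow> 'n \<Rightarrow> 'n \<Rightarrow> real"
  proof -
    have "(\<Sum>i\<in>UNIV. \<Sum>j\<in>UNIV. \<Sum>l\<in>UNIV. f l i j) = (\<Sum>i\<in>UNIV. \<Sum>l\<in>UNIV. \<Sum>j\<in>UNIV. f l i j)"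
      by (rule sum.cong[OF refl sum.swap])
    also have "\<dots> = (\<Sum>l\<in>UNIV. \<Sum>i\<in>UNIV. \<Sum>j\<in>UNIV. f l i j)" by (rule sum.swap)
    finally show ?thesis .
  qed
  have "C + C + C = (\<Sum>i\<in>UNIV. \<Sum>j\<in>UNIV. \<Sum>l\<in>UNIV. c i j l + c j l i + c l i j)"
    using rot[of c] rot[of "\<lambda>i j l. c j l i"] by (simp only: sum.distrib C_def)
  then have "C = 0" by (simp add: cyc)
  have "(\<Sum>i\<in>UNIV. (repulsion i x)\<^sup>2) = (\<Sum>i\<in>UNIV. \<Sum>j\<in>UNIV. \<Sum>l\<in>UNIV. ?g i j l)"
    by (simp only: repulsion_def power2_eq_square sum_product)
  also have "\<dots> = (\<Sum>i\<in>UNIV. \<Sum>j\<in>UNIV. \<Sum>l\<in>UNIV. c i j l + (if l = j then 1 / (x $ i - x $ j)\<^sup>2 else 0))"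
    by (intro sum.cong refl) (auto simp: c_def power2_eq_square)
  also have "\<dots> = C + (\<Sum>i\<in>UNIV. \<Sum>j\<in>UNIV. 1 / (x $ i - x $ j)\<^sup>2)"
    by (simp add: sum.distrib C_def)
  finally show ?thesis using \<open>C = 0\<close> by simp
qed

section \<open>Truncation of the power function\<close>

text \<open>
  The \<open>p\<close>-th power of \<open>\<omega>(t) = (t - \<epsilon>)^2 / t\<close> for \<open>t > \<epsilon>\<close>, continued by zero. This \<open>\<omega>\<close> is convex with
  \<open>0 \<le> \<omega>' = 1 - (\<epsilon>/t)^2 \<le> 1\<close> and tends to \<open>t\<close> as \<open>\<epsilon>\<close> tends to zero. Since it vanishes quadratically at
  \<open>\<epsilon>\<close> and \<open>p > 1\<close>, its \<open>p\<close>-th power is of class \<open>C^2\<close> even for \<open>p < 2\<close>.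
\<close>

definition cutoff :: "real \<Rightarrow> real \<Rightarrow> real \<Rightarrow> real" where
  "cutoff p \<epsilon> t = max (t - \<epsilon>) 0 powr (2*p) * t powr (-p)"

text \<open>
  This is \<open>\<omega>^(p-1) \<omega>'\<close>, hence \<open>1/p\<close> times the derivative of \<open>\<omega>^p\<close>; it replaces \<open>|u|^(p-2) u\<close>.
\<close>

definition cutoff' :: "real \<Rightarrow> real \<Rightarrow> real \<Rightarrow> real" where
  "cutoff' p \<epsilon> t = max (t - \<epsilon>) 0 powr (2*p - 1) * t powr (-p - 1) * (t + \<epsilon>)"

text \<open>
  The derivative of \<open>\<omega>^(p-1) \<omega>'\<close>.
\<close>

definition cutoff'' :: "real \<Rightarrow> real \<Rightarrow> real \<Rightarrow> real" where
  "cutoff'' p \<epsilon> t = max (t - \<epsilon>) 0 powr (2*p - 2) * t powr (-p - 2)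
     * ((p - 1) * t\<^sup>2 + 2 * (p - 1) * \<epsilon> * t + (p + 1) * \<epsilon>\<^sup>2)"

text \<open>
  At \<open>z = 0\<close> the difference quotient is at most \<open>|h|^(n-1)\<close> in absolute value, which tends to zero because \<open>n > 1\<close>.
\<close>

lemma DERIV_max_powr:
  fixes n z :: real
  assumes "n > 1"
  shows "((\<lambda>z. max z 0 powr n) has_real_derivative n * max z 0 powr (n - 1)) (at z)"
proof -
  consider "z > 0" | "z < 0" | "z = 0" by linarith
  then show ?thesis
  proof cases
    case 1
    have "((\<lambda>z. z powr n) has_real_derivative n * z powr (n - 1)) (at z)"
      using 1 by (rule has_real_derivative_powr)
    then have "((\<lambda>z. max z 0 powr n) has_real_derivative n * z powr (n - 1)) (at z)"
      by (rule has_field_derivative_transform_within_open[of _ _ _ "{0<..}"]) (use 1 in auto)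
    then show ?thesis using 1 by (simp add: max_def)
  next
    case 2
    have "((\<lambda>z. max z 0 powr n) has_real_derivative 0) (at z)"
      by (rule has_field_derivative_transform_within_open[of "\<lambda>_. 0" _ _ "{..<0}"]) (use 2 in auto)
    then show ?thesis using 2 by (simp add: max_def)
  next
    case 3
    have "((\<lambda>h. max h 0 powr n / h) \<longlongrightarrow> 0) (at 0)"
    proof (rule Lim_null_comparison)
      show "\<forall>\<^sub>F h in at 0. norm (max h 0 powr n / h) \<le> \<bar>h\<bar> powr (n - 1)"
        by (intro always_eventually allI) (auto simp: max_def powr_diff divide_nonneg_nonpos)
      show "((\<lambda>h::real. \<bar>h\<bar> powr (n - 1)) \<longlongrightarrow> 0) (at 0)"
        using assms by (auto intro!: tendsto_eq_intros tendsto_zero_powrI)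
    qed
    then show ?thesis using 3 assms by (simp add: DERIV_def)
  qed
qed

lemma DERIV_max_diff_powr:
  fixes n t \<epsilon> :: real
  assumes "n > 1"
  shows "((\<lambda>t. max (t - \<epsilon>) 0 powr n) has_real_derivative n * max (t - \<epsilon>) 0 powr (n - 1)) (at t)"
proof -
  have "((\<lambda>t. t - \<epsilon>) has_real_derivative 1) (at t)" by (auto intro!: derivative_eq_intros)
  from DERIV_chain2[OF DERIV_max_powr[OF assms] this] show ?thesis by simp
qed

lemma DERIV_cutoff:
  assumes "p > 1" "\<epsilon> > 0"
  shows "(cutoff p \<epsilon> has_real_derivative p * cutoff' p \<epsilon> t) (at t)"
proof (cases "t < \<epsilon>")
  case True
  have "(cutoff p \<epsilon> has_real_derivative 0) (at t)"
    by (rule has_field_derivative_transform_within_open[of "\<lambda>_. 0" _ _ "{..<\<epsilon>}"])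
      (use True assms in \<open>auto simp: cutoff_def\<close>)
  then show ?thesis using True assms by (simp add: cutoff'_def)
next
  case False
  then have t: "t > 0" using assms by linarith
  have y: "max (t - \<epsilon>) 0 = t - \<epsilon>" using False by simp
  have der: "(cutoff p \<epsilon> has_real_derivative
     2*p * (t - \<epsilon>) powr (2*p - 1) * t powr (-p) + (t - \<epsilon>) powr (2*p) * (-p * t powr (-p - 1))) (at t)"
    unfolding cutoff_def
    using DERIV_mult[OF DERIV_max_diff_powr[of "2*p" \<epsilon> t] has_real_derivative_powr[OF t, of "-p"]] assms
    by (simp add: y algebra_simps)
  have "(t - \<epsilon>) powr (2*p) = (t - \<epsilon>) powr (2*p - 1) * (t - \<epsilon>)"
    using False assms powr_mult_base[of "t - \<epsilon>" "2*p - 1"] by (simp add: mult.commute)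
  moreover have "t powr (-p) = t powr (-p - 1) * t"
    using t powr_mult_base[of t "-p - 1"] by (simp add: mult.commute)
  ultimately have "2*p * (t - \<epsilon>) powr (2*p - 1) * t powr (-p) + (t - \<epsilon>) powr (2*p) * (-p * t powr (-p - 1))
      = p * cutoff' p \<epsilon> t"
    unfolding cutoff'_def y by algebra
  with der show ?thesis by simp
qed

lemma DERIV_cutoff':
  assumes "p > 1" "\<epsilon> > 0"
  shows "(cutoff' p \<epsilon> has_real_derivative cutoff'' p \<epsilon> t) (at t)"
proof (cases "t < \<epsilon>")
  case True
  have "(cutoff' p \<epsilon> has_real_derivative 0) (at t)"
    by (rule has_field_derivative_transform_within_open[of "\<lambda>_. 0" _ _ "{..<\<epsilon>}"])
      (use True assms in \<open>auto simp: cutoff'_def\<close>)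
  then show ?thesis using True assms by (simp add: cutoff''_def)
next
  case False
  then have t: "t > 0" using assms by linarith
  have y: "max (t - \<epsilon>) 0 = t - \<epsilon>" using False by simp
  have der: "(cutoff' p \<epsilon> has_real_derivative
     ((2*p - 1) * (t - \<epsilon>) powr (2*p - 2) * t powr (-p - 1)
       + (t - \<epsilon>) powr (2*p - 1) * ((-p - 1) * t powr (-p - 2))) * (t + \<epsilon>)
     + (t - \<epsilon>) powr (2*p - 1) * t powr (-p - 1)) (at t)"
    unfolding cutoff'_def
    using DERIV_mult[OF DERIV_mult[OF DERIV_max_diff_powr[of "2*p - 1" \<epsilon> t]
        has_real_derivative_powr[OF t, of "-p - 1"]] DERIV_add[OF DERIV_ident DERIV_const[of \<epsilon>]]] assms
    by (simp add: y algebra_simps)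
  have "(t - \<epsilon>) powr (2*p - 1) = (t - \<epsilon>) powr (2*p - 2) * (t - \<epsilon>)"
    using False assms powr_mult_base[of "t - \<epsilon>" "2*p - 2"] by (simp add: mult.commute)
  moreover have "t powr (-p - 1) = t powr (-p - 2) * t"
  proof -
    have e: "-p - 2 + 1 = -p - 1" by simp
    show ?thesis using powr_add[of t "-p - 2" 1, unfolded e] t by simp
  qed
  ultimately have "((2*p - 1) * (t - \<epsilon>) powr (2*p - 2) * t powr (-p - 1)
       + (t - \<epsilon>) powr (2*p - 1) * ((-p - 1) * t powr (-p - 2))) * (t + \<epsilon>)
     + (t - \<epsilon>) powr (2*p - 1) * t powr (-p - 1) = cutoff'' p \<epsilon> t"
    unfolding cutoff''_def y by algebra
  with der show ?thesis by simp
qed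

lemma continuous_cutoff'':
  assumes "p > 1" "\<epsilon> > 0"
  shows "continuous_on UNIV (cutoff'' p \<epsilon>)"
proof -
  have "continuous_on {0<..} (cutoff'' p \<epsilon>)"
    unfolding cutoff''_def using assms by (intro continuous_intros continuous_on_powr') auto
  moreover have "continuous_on {..<\<epsilon>} (cutoff'' p \<epsilon>)"
    by (rule continuous_on_eq[of _ "\<lambda>_. 0"]) (auto simp: cutoff''_def)
  ultimately have "continuous_on ({0<..} \<union> {..<\<epsilon>}) (cutoff'' p \<epsilon>)"
    by (intro continuous_on_open_Un) auto
  moreover have "{0<..} \<union> {..<\<epsilon>} = UNIV" using assms by auto
  ultimately show ?thesis by simp
qed

text \<open>
  In these formulas \<open>w = \<omega>(t)\<close>, \<open>1 - (\<epsilon>/t)^2 = \<omega>'(t)\<close> and \<open>2 \<epsilon>^2 / t^3 = \<omega>''(t)\<close>. They exhibit the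
  structure \<open>(\<omega>^(p-1) \<omega>')' = \<omega>^(p-2) ((p-1) \<omega>'^2 + \<omega> \<omega>'')\<close>.
\<close>

lemma cutoff_powers:
  assumes "p > 1" "\<epsilon> > 0" "t > \<epsilon>"
  defines "w \<equiv> (t - \<epsilon>)\<^sup>2 / t"
  shows "w > 0" and "cutoff p \<epsilon> t = w powr p"
    and "cutoff' p \<epsilon> t = w powr (p - 1) * (1 - (\<epsilon> / t)\<^sup>2)"
    and "cutoff'' p \<epsilon> t = w powr (p - 2) * ((p - 1) * (1 - (\<epsilon> / t)\<^sup>2)\<^sup>2 + w * (2 * \<epsilon>\<^sup>2 / t^3))"
proof -
  have t: "t > 0" "t - \<epsilon> > 0" using assms by auto
  show "w > 0" using t by (simp add: w_def)
  have m: "max (t - \<epsilon>) 0 = t - \<epsilon>" using assms by simp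
  have sq: "(t - \<epsilon>)\<^sup>2 = (t - \<epsilon>) powr 2" using t by simp
  have wp: "w powr r = (t - \<epsilon>) powr (2 * r) * t powr (- r)" for r
    using t by (simp only: w_def sq powr_divide powr_powr powr_minus) (simp add: divide_inverse powr_minus)
  show "cutoff p \<epsilon> t = w powr p" by (simp add: cutoff_def m wp)
  have "(t - \<epsilon>) powr (2*p - 1) = (t - \<epsilon>) powr (2 * (p - 1)) * (t - \<epsilon>)"
    using t powr_add[of "t - \<epsilon>" "2*(p-1)" 1] by (simp add: algebra_simps)
  moreover have "t powr (-p - 1) = t powr (- (p - 1)) / t^2"
  proof -
    have "-p - 1 = - (p - 1) - 2" by simp
    then show ?thesis using t by (simp only: powr_diff) simp
  qed
  ultimately show "cutoff' p \<epsilon> t = w powr (p - 1) * (1 - (\<epsilon> / t)\<^sup>2)"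
    using t by (simp add: cutoff'_def m wp) (simp add: field_simps power2_eq_square)
  have a: "(t - \<epsilon>) powr (2*p - 2) = (t - \<epsilon>) powr (2 * (p - 2)) * (t - \<epsilon>)^2"
    using t powr_add[of "t - \<epsilon>" "2*(p-2)" 2] by (simp add: algebra_simps)
  have b: "t powr (-p - 2) = t powr (- (p - 2)) / t^4"
    using t powr_diff[of t "- (p - 2)" 4] by (simp add: algebra_simps)
  have c: "(t - \<epsilon>)^2 / t^4 * ((p - 1) * t\<^sup>2 + 2 * (p - 1) * \<epsilon> * t + (p + 1) * \<epsilon>\<^sup>2)
      = (p - 1) * (1 - (\<epsilon> / t)\<^sup>2)\<^sup>2 + w * (2 * \<epsilon>\<^sup>2 / t^3)"
    using t unfolding w_def by (simp add: field_simps) algebra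
  have "cutoff'' p \<epsilon> t = (t - \<epsilon>) powr (2 * (p - 2)) * t powr (- (p - 2)) *
      ((t - \<epsilon>)^2 / t^4 * ((p - 1) * t\<^sup>2 + 2 * (p - 1) * \<epsilon> * t + (p + 1) * \<epsilon>\<^sup>2))"
    unfolding cutoff''_def m a b by simp
  also have "\<dots> = w powr (p - 2) * ((p - 1) * (1 - (\<epsilon> / t)\<^sup>2)\<^sup>2 + w * (2 * \<epsilon>\<^sup>2 / t^3))"
    unfolding wp c ..
  finally show "cutoff'' p \<epsilon> t = w powr (p - 2) * ((p - 1) * (1 - (\<epsilon> / t)\<^sup>2)\<^sup>2 + w * (2 * \<epsilon>\<^sup>2 / t^3))" .
qed

lemma cutoff_eq_0:
  assumes "p > 1" "t \<le> \<epsilon>"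
  shows "cutoff p \<epsilon> t = 0" "cutoff' p \<epsilon> t = 0" "cutoff'' p \<epsilon> t = 0"
  using assms by (auto simp: cutoff_def cutoff'_def cutoff''_def)

text \<open>
  The fourth inequality is the convexity of \<open>\<omega>\<close>: the two sides differ by \<open>\<omega>^(2p-1) \<omega>''\<close>. The
  last one is \<open>\<omega>' \<le> 1\<close>.
\<close>

lemma cutoff_ineqs:
  assumes "p > 1" "\<epsilon> > 0"
  shows "0 \<le> cutoff p \<epsilon> t" and "cutoff p \<epsilon> t \<le> \<bar>t\<bar> powr p"
    and "0 \<le> cutoff'' p \<epsilon> t"
    and "(p - 1) * (cutoff' p \<epsilon> t)\<^sup>2 \<le> cutoff'' p \<epsilon> t * cutoff p \<epsilon> t"
    and "\<bar>cutoff' p \<epsilon> t\<bar> \<le> cutoff p \<epsilon> t powr ((p - 1) / p)"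
proof -
  have "0 \<le> cutoff p \<epsilon> t \<and> cutoff p \<epsilon> t \<le> \<bar>t\<bar> powr p \<and> 0 \<le> cutoff'' p \<epsilon> t \<and>
    (p - 1) * (cutoff' p \<epsilon> t)\<^sup>2 \<le> cutoff'' p \<epsilon> t * cutoff p \<epsilon> t \<and>
    \<bar>cutoff' p \<epsilon> t\<bar> \<le> cutoff p \<epsilon> t powr ((p - 1) / p)"
  proof (cases "t \<le> \<epsilon>")
    case True
    then show ?thesis using assms by (simp add: cutoff_eq_0)
  next
    case False
    then have t: "t > \<epsilon>" "t > 0" using assms by auto
    define w where "w = (t - \<epsilon>)\<^sup>2 / t"
    define d where "d = 1 - (\<epsilon> / t)\<^sup>2"
    define b where "b = w * (2 * \<epsilon>\<^sup>2 / t^3)"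
    note cp = cutoff_powers[OF assms t(1), folded w_def, folded d_def, folded b_def]
    have w: "w > 0" by (rule cp)
    have b: "b \<ge> 0" using w t assms by (simp add: b_def)
    have d: "0 \<le> d" "d \<le> 1" using t assms by (auto simp: d_def power_le_one)
    have wt: "w \<le> t"
    proof -
      have "(t - \<epsilon>)\<^sup>2 \<le> t\<^sup>2" using t assms by (intro power_mono) auto
      then show ?thesis using t by (simp add: w_def field_simps power2_eq_square)
    qed
    have e: "w powr (p - 1) * w powr (p - 1) = w powr (p - 2) * w powr p"
      by (simp add: powr_add[symmetric])
    have "(p - 1) * (w powr (p - 1) * d)\<^sup>2 = w powr (p - 2) * ((p - 1) * d\<^sup>2) * w powr p"
      using e by (simp add: power_mult_distrib power2_eq_square algebra_simps)
    also have "\<dots> \<le> w powr (p - 2) * ((p - 1) * d\<^sup>2 + b) * w powr p"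
      using b by (intro mult_right_mono mult_left_mono) auto
    finally have "(p - 1) * (w powr (p - 1) * d)\<^sup>2 \<le> w powr (p - 2) * ((p - 1) * d\<^sup>2 + b) * w powr p" .
    moreover have "w powr p \<le> \<bar>t\<bar> powr p" using w wt t assms by (intro powr_mono2) auto
    moreover have "\<bar>w powr (p - 1) * d\<bar> \<le> (w powr p) powr ((p - 1) / p)"
    proof -
      have "p * ((p - 1) / p) = p - 1" using assms by simp
      then show ?thesis using d by (simp add: powr_powr abs_mult mult_left_le del: times_divide_eq_right)
    qed
    moreover have "0 \<le> w powr (p - 2) * ((p - 1) * d\<^sup>2 + b)"
      using assms b by auto
    ultimately show ?thesis unfolding cp(2-4) by simp
  qed
  then show "0 \<le> cutoff p \<epsilon> t" and "cutoff p \<epsilon> t \<le> \<bar>t\<bar> powr p"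
    and "0 \<le> cutoff'' p \<epsilon> t"
    and "(p - 1) * (cutoff' p \<epsilon> t)\<^sup>2 \<le> cutoff'' p \<epsilon> t * cutoff p \<epsilon> t"
    and "\<bar>cutoff' p \<epsilon> t\<bar> \<le> cutoff p \<epsilon> t powr ((p - 1) / p)" by auto
qed

text \<open>
  The even extension to both signs; at every \<open>t\<close> at most one of the two summands is nonzero.
\<close>

definition truncation :: "real \<Rightarrow> real \<Rightarrow> real \<Rightarrow> real" where
  "truncation p \<epsilon> t = cutoff p \<epsilon> t + cutoff p \<epsilon> (- t)"

definition truncation' :: "real \<Rightarrow> real \<Rightarrow> real \<Rightarrow> real" where
  "truncation' p \<epsilon> t = cutoff' p \<epsilon> t - cutoff' p \<epsilon> (- t)"

definition truncation'' :: "real \<Rightarrow> real \<Rightarrow> real \<Rightarrow> real" where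
  "truncation'' p \<epsilon> t = cutoff'' p \<epsilon> t + cutoff'' p \<epsilon> (- t)"

lemma DERIV_truncation:
  assumes "p > 1" "\<epsilon> > 0"
  shows "(truncation p \<epsilon> has_real_derivative p * truncation' p \<epsilon> t) (at t)"
    and "(truncation' p \<epsilon> has_real_derivative truncation'' p \<epsilon> t) (at t)"
proof -
  have neg: "(uminus has_real_derivative - 1) (at t)" by (auto intro!: derivative_eq_intros)
  show "(truncation p \<epsilon> has_real_derivative p * truncation' p \<epsilon> t) (at t)"
    unfolding truncation_def
    using DERIV_add[OF DERIV_cutoff[OF assms] DERIV_chain2[OF DERIV_cutoff[OF assms] neg]]
    by (simp add: truncation'_def algebra_simps)
  show "(truncation' p \<epsilon> has_real_derivative truncation'' p \<epsilon> t) (at t)"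
    unfolding truncation'_def
    using DERIV_diff[OF DERIV_cutoff'[OF assms] DERIV_chain2[OF DERIV_cutoff'[OF assms] neg]]
    by (simp add: truncation''_def)
qed

lemma continuous_truncation:
  assumes "p > 1" "\<epsilon> > 0"
  shows "continuous_on UNIV (truncation p \<epsilon>)" "continuous_on UNIV (truncation' p \<epsilon>)"
    "continuous_on UNIV (truncation'' p \<epsilon>)"
proof -
  show "continuous_on UNIV (truncation p \<epsilon>)" "continuous_on UNIV (truncation' p \<epsilon>)"
    using DERIV_truncation[OF assms] by (auto intro!: DERIV_continuous_on)
  have "continuous_on UNIV (\<lambda>t. cutoff'' p \<epsilon> (- t))"
    by (rule continuous_on_compose2[OF continuous_cutoff''[OF assms]]) (auto intro: continuous_intros)
  then show "continuous_on UNIV (truncation'' p \<epsilon>)"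
    unfolding truncation''_def by (intro continuous_intros continuous_cutoff''[OF assms])
qed

lemma truncation_eq_0:
  assumes "p > 1" "\<bar>t\<bar> \<le> \<epsilon>"
  shows "truncation p \<epsilon> t = 0" "truncation' p \<epsilon> t = 0" "truncation'' p \<epsilon> t = 0"
  using assms by (auto simp: truncation_def truncation'_def truncation''_def cutoff_eq_0)

lemma truncation_ineqs:
  assumes "p > 1" "\<epsilon> > 0"
  shows "0 \<le> truncation p \<epsilon> t" and "truncation p \<epsilon> t \<le> \<bar>t\<bar> powr p"
    and "0 \<le> truncation'' p \<epsilon> t"
    and "(p - 1) * (truncation' p \<epsilon> t)\<^sup>2 \<le> truncation'' p \<epsilon> t * truncation p \<epsilon> t"
    and "\<bar>truncation' p \<epsilon> t\<bar> \<le> truncation p \<epsilon> t powr ((p - 1) / p)"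
proof -
  consider "t \<le> \<epsilon>" | "- t \<le> \<epsilon>" using assms by linarith
  then have "0 \<le> truncation p \<epsilon> t \<and> truncation p \<epsilon> t \<le> \<bar>t\<bar> powr p \<and> 0 \<le> truncation'' p \<epsilon> t \<and>
    (p - 1) * (truncation' p \<epsilon> t)\<^sup>2 \<le> truncation'' p \<epsilon> t * truncation p \<epsilon> t \<and>
    \<bar>truncation' p \<epsilon> t\<bar> \<le> truncation p \<epsilon> t powr ((p - 1) / p)"
  proof cases
    case 1
    then show ?thesis using cutoff_ineqs[OF assms, of "- t"] assms
      by (simp add: truncation_def truncation'_def truncation''_def cutoff_eq_0)
  next
    case 2
    then show ?thesis using cutoff_ineqs[OF assms, of t] assms
      by (simp add: truncation_def truncation'_def truncation''_def cutoff_eq_0)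
  qed
  then show "0 \<le> truncation p \<epsilon> t" and "truncation p \<epsilon> t \<le> \<bar>t\<bar> powr p"
    and "0 \<le> truncation'' p \<epsilon> t"
    and "(p - 1) * (truncation' p \<epsilon> t)\<^sup>2 \<le> truncation'' p \<epsilon> t * truncation p \<epsilon> t"
    and "\<bar>truncation' p \<epsilon> t\<bar> \<le> truncation p \<epsilon> t powr ((p - 1) / p)" by auto
qed

lemma truncation_tendsto:
  assumes "p > 1" "\<epsilon> \<longlonglongrightarrow> 0"
  shows "(\<lambda>n. truncation p (\<epsilon> n) t) \<longlonglongrightarrow> \<bar>t\<bar> powr p"
proof -
  have "(\<lambda>n. truncation p (\<epsilon> n) t)
      \<longlonglongrightarrow> max (t - 0) 0 powr (2*p) * t powr (-p) + max (- t - 0) 0 powr (2*p) * (- t) powr (-p)"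
    unfolding truncation_def cutoff_def using assms by (intro tendsto_intros) auto
  also have "max (t - 0) 0 powr (2*p) * t powr (-p) + max (- t - 0) 0 powr (2*p) * (- t) powr (-p) = \<bar>t\<bar> powr p"
    using assms by (cases "t > 0"; cases "t < 0") (auto simp: powr_add[symmetric])
  finally show ?thesis .
qed

section \<open>Partial derivatives as derivatives along coordinate lines\<close>

lemma DERIV_partial:
  fixes f :: "real^'n \<Rightarrow> real"
  assumes "f differentiable (at x)"
  shows "((\<lambda>t. f (x + t *\<^sub>R axis i 1)) has_real_derivative partial i f x) (at 0)"
proof -
  have f: "(f has_derivative frechet_derivative f (at x)) (at (x + 0 *\<^sub>R axis i 1))"
    using assms by (simp add: frechet_derivative_works)
  have "((\<lambda>t. x + t *\<^sub>R axis i 1) has_derivative (\<lambda>t. t *\<^sub>R axis i 1)) (at (0::real))"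
    by (auto intro!: derivative_eq_intros)
  from has_derivative_compose[OF this f]
  have "((\<lambda>t. f (x + t *\<^sub>R axis i 1)) has_derivative (\<lambda>t. frechet_derivative f (at x) (t *\<^sub>R axis i 1))) (at 0)" .
  moreover have "frechet_derivative f (at x) (t *\<^sub>R axis i 1) = partial i f x * t" for t :: real
    using assms linear_frechet_derivative[of f "at x"] by (simp add: linear_scale partial_def)
  ultimately show ?thesis by (simp add: has_field_derivative_def)
qed

lemma partial_locally_zero:
  assumes "open U" and "\<And>y. y \<in> U \<Longrightarrow> f y = 0" and "x \<in> U"
  shows "partial i f x = 0"
proof -
  have "(f has_derivative (\<lambda>_. 0)) (at x)"
    by (rule has_derivative_transform_within_open[of "\<lambda>_. 0" _ _ _ U]) (use assms in auto)
  from frechet_derivative_at[OF this, symmetric] show ?thesis by (simp add: partial_def)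
qed

lemma axis_line_nth: "(x + t *\<^sub>R axis i (1::real)) $ j = x $ j + (if j = i then t else 0)"
  by (simp add: axis_def)

lemma axis_line_inner:
  "(x + t *\<^sub>R axis i 1) \<bullet> (x + t *\<^sub>R axis i 1) = x \<bullet> x + 2 * t * (x $ i) + t\<^sup>2" for x :: "real^'n"
  by (simp add: inner_add_left inner_add_right inner_axis inner_commute[of "axis i 1"] power2_eq_square algebra_simps)

section \<open>The drift field\<close>

lemma DERIV_repulsion:
  fixes x :: "real^'n"
  assumes "distinct_coords x"
  shows "((\<lambda>t. repulsion i (x + t *\<^sub>R axis i 1)) has_real_derivative
    - (\<Sum>j\<in>UNIV. 1 / (x $ i - x $ j)\<^sup>2)) (at 0)"
proof -
  have "((\<lambda>t. 1 / ((x + t *\<^sub>R axis i 1) $ i - (x + t *\<^sub>R axis i 1) $ j)) has_real_derivative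
    - (1 / (x $ i - x $ j)\<^sup>2)) (at 0)" for j
  proof (cases "j = i")
    case False
    then have "x $ i - x $ j \<noteq> 0" using assms by (auto simp: distinct_coords_def)
    with False show ?thesis unfolding axis_line_nth
      by (auto intro!: derivative_eq_intros simp: power2_eq_square)
  qed simp
  then show ?thesis unfolding repulsion_def sum_negf[symmetric] by (intro DERIV_sum)
qed

lemma DERIV_radial_weight:
  fixes x :: "real^'n"
  assumes "x \<noteq> 0"
  shows "((\<lambda>t. ((x + t *\<^sub>R axis i 1) \<bullet> (x + t *\<^sub>R axis i 1)) powr b) has_real_derivative
    2 * b * (x $ i) / (x \<bullet> x) * (x \<bullet> x) powr b) (at 0)"
proof -
  have pos: "x \<bullet> x > 0" using assms by simp
  have q: "((\<lambda>t. x \<bullet> x + 2 * t * (x $ i) + t\<^sup>2) has_real_derivative 2 * (x $ i)) (at 0)"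
    by (auto intro!: derivative_eq_intros)
  have "((\<lambda>z. z powr b) has_real_derivative b * (x \<bullet> x) powr (b - 1)) (at (x \<bullet> x + 2 * 0 * (x $ i) + 0\<^sup>2))"
    using has_real_derivative_powr[OF pos] by simp
  from DERIV_chain2[OF this q] show ?thesis
    using pos by (simp add: axis_line_inner powr_diff mult_ac)
qed

text \<open>
  The field \<open>E = \<beta> B - (a/p) x / r^2\<close> with \<open>B = s x / r^2 + A\<close>, \<open>\<beta> = 4(p-1)/p^2\<close> and
  \<open>s = - (d^2 - 2 - a) / 2\<close>, so the coefficient of \<open>x / r^2\<close> is \<open>\<beta> s - a/p\<close>. The part \<open>\<beta> B\<close>
  comes from the Hardy inequality, the rest from integrating \<open>\<nabla>(|u|^p) \<bullet> \<nabla>(r^(-a))\<close> by parts.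
\<close>

definition drift :: "real \<Rightarrow> real \<Rightarrow> 'n::finite \<Rightarrow> real^'n \<Rightarrow> real" where
  "drift p a i x =
     (- 2 * (p - 1) * ((real CARD('n))\<^sup>2 - 2 - a) / p\<^sup>2 - a / p) * (x $ i / (x \<bullet> x))
       + 4 * (p - 1) / p\<^sup>2 * repulsion i x"

definition drift_deriv :: "real \<Rightarrow> real \<Rightarrow> 'n::finite \<Rightarrow> real^'n \<Rightarrow> real" where
  "drift_deriv p a i x =
     (- 2 * (p - 1) * ((real CARD('n))\<^sup>2 - 2 - a) / p\<^sup>2 - a / p) * (1 / (x \<bullet> x) - 2 * (x $ i)\<^sup>2 / (x \<bullet> x)\<^sup>2)
       - 4 * (p - 1) / p\<^sup>2 * (\<Sum>j\<in>UNIV. 1 / (x $ i - x $ j)\<^sup>2)"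

lemma DERIV_drift:
  fixes x :: "real^'n"
  assumes "distinct_coords x" "x \<noteq> 0"
  shows "((\<lambda>t. drift p a i (x + t *\<^sub>R axis i 1)) has_real_derivative drift_deriv p a i x) (at 0)"
proof -
  have "((\<lambda>t. (x + t *\<^sub>R axis i 1) $ i / ((x + t *\<^sub>R axis i 1) \<bullet> (x + t *\<^sub>R axis i 1))) has_real_derivative
     1 / (x \<bullet> x) - 2 * (x $ i)\<^sup>2 / (x \<bullet> x)\<^sup>2) (at 0)"
    unfolding axis_line_nth axis_line_inner using assms
    by (auto intro!: derivative_eq_intros simp: field_simps power2_eq_square)
  from DERIV_add[OF DERIV_cmult[OF this] DERIV_cmult[OF DERIV_repulsion[OF assms(1)]]]
  show ?thesis unfolding drift_def drift_deriv_def by (rule DERIV_cong) simp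
qed

section \<open>The pointwise inequality\<close>

text \<open>
  One coordinate of \<open>|\<nabla>v - v B|^2 \<ge> 0\<close>: with \<open>\<theta>\<close>, \<open>\<psi>\<close>, \<open>\<kappa>\<close> in the roles of \<open>|u|^p\<close>, \<open>|u|^(p-2) u\<close>
  and the derivative of the latter, the difference of the two sides is, for \<open>\<theta> > 0\<close>, at least
  \<open>(p-1)/\<theta> (\<psi> g - (2/p) \<theta> b)^2\<close>.
\<close>

lemma quadratic_absorption:
  fixes p \<theta> \<psi> \<kappa> g b :: real
  assumes "p > 1" "\<theta> \<ge> 0" "\<kappa> \<ge> 0" "(p - 1) * \<psi>\<^sup>2 \<le> \<kappa> * \<theta>"
  shows "4 * (p - 1) / p * \<psi> * g * b - \<kappa> * g\<^sup>2 \<le> 4 * (p - 1) / p\<^sup>2 * \<theta> * b\<^sup>2"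
proof (cases "\<theta> = 0")
  case True
  then have "\<psi> = 0" using assms by (simp add: mult_le_0_iff)
  then show ?thesis using assms True by simp
next
  case False
  then have \<theta>: "\<theta> > 0" using assms by simp
  have "(p - 1) * \<psi>\<^sup>2 / \<theta> * g\<^sup>2 \<le> \<kappa> * g\<^sup>2"
    using assms \<theta> by (intro mult_right_mono) (auto simp: divide_le_eq)
  moreover have "(p - 1) * \<psi>\<^sup>2 / \<theta> * g\<^sup>2 - 4 * (p - 1) / p * \<psi> * g * b + 4 * (p - 1) / p\<^sup>2 * \<theta> * b\<^sup>2
      = (p - 1) / \<theta> * (\<psi> * g - 2 / p * \<theta> * b)\<^sup>2"
    using \<theta> assms by (simp add: field_simps) algebra
  moreover have "(p - 1) / \<theta> * (\<psi> * g - 2 / p * \<theta> * b)\<^sup>2 \<ge> 0" using assms \<theta> by simp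
  ultimately show ?thesis by linarith
qed

text \<open>
  The sum is \<open>r^a div F + \<psi> \<Delta>u\<close> at a point where \<open>g\<close> is the gradient of \<open>u\<close>. The first-order terms
  in \<open>g\<close> combine to \<open>p \<beta> \<psi> g \<bullet> B\<close>, so after \<open>quadratic_absorption\<close> only multiples of \<open>\<theta>\<close> remain. In
  their sum \<open>|A|^2\<close> cancels against \<open>div A\<close>, and the coefficient of \<open>\<theta> / r^2\<close> becomes \<open>- N / p^2\<close> by
  the choice of \<open>s\<close>.
\<close>

lemma divergence_bound:
  fixes x :: "real^'n" and g :: "'n \<Rightarrow> real" and p \<gamma> \<theta> \<psi> \<kappa> :: real
  assumes x: "distinct_coords x" "x \<noteq> 0" and p: "p > 1"
    and \<theta>: "\<theta> \<ge> 0" "\<kappa> \<ge> 0" "(p - 1) * \<psi>\<^sup>2 \<le> \<kappa> * \<theta>"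
  defines "a \<equiv> \<gamma> + 2 * p - 2"
  shows "(\<Sum>i\<in>UNIV. - a * (x $ i / (x \<bullet> x)) * (\<theta> * drift p a i x - \<psi> * g i)
      + p * \<psi> * g i * drift p a i x + \<theta> * drift_deriv p a i x - \<kappa> * (g i)\<^sup>2)
    \<le> - (rellich_N (real CARD('n)) p \<gamma> / p\<^sup>2) * (\<theta> / (x \<bullet> x))"
proof -
  define d where "d = real CARD('n)"
  define \<rho> where "\<rho> = x \<bullet> x"
  define \<beta> where "\<beta> = 4 * (p - 1) / p\<^sup>2"
  define s where "s = - (d\<^sup>2 - 2 - a) / 2"
  define \<alpha> where "\<alpha> = \<beta> * s - a / p"
  define A where "A i = repulsion i x" for i
  define Q where "Q i = (\<Sum>j\<in>UNIV. 1 / (x $ i - x $ j)\<^sup>2)" for i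
  have \<rho>: "\<rho> > 0" using x by (simp add: \<rho>_def)
  have \<alpha>': "- 2 * (p - 1) * (d\<^sup>2 - 2 - a) / p\<^sup>2 - a / p = \<alpha>"
    by (simp add: \<alpha>_def \<beta>_def s_def algebra_simps add_divide_distrib diff_divide_distrib)
  have E: "drift p a i x = \<alpha> * (x $ i / \<rho>) + \<beta> * A i" for i
    unfolding drift_def A_def \<beta>_def d_def[symmetric] \<rho>_def[symmetric] \<alpha>' ..
  have E': "drift_deriv p a i x = \<alpha> * (1 / \<rho> - 2 * (x $ i)\<^sup>2 / \<rho>\<^sup>2) - \<beta> * Q i" for i
    unfolding drift_deriv_def Q_def \<beta>_def d_def[symmetric] \<rho>_def[symmetric] \<alpha>' ..
  have sx: "(\<Sum>i\<in>UNIV. (x $ i)\<^sup>2) = \<rho>"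
    by (simp add: \<rho>_def inner_vec_def power2_eq_square)
  have sxA: "(\<Sum>i\<in>UNIV. x $ i * A i) = d * (d - 1) / 2"
    using inner_repulsion[OF x(1)] by (simp add: A_def d_def)
  have sA: "(\<Sum>i\<in>UNIV. (A i)\<^sup>2) = (\<Sum>i\<in>UNIV. Q i)"
    using sum_repulsion_squared[OF x(1)] by (simp add: A_def Q_def)
  have termwise: "- a * (x $ i / \<rho>) * (\<theta> * drift p a i x - \<psi> * g i)
      + p * \<psi> * g i * drift p a i x + \<theta> * drift_deriv p a i x - \<kappa> * (g i)\<^sup>2
    \<le> \<theta> * ((- a * \<alpha> - 2 * \<alpha> + \<beta> * s\<^sup>2) / \<rho>\<^sup>2 * (x $ i)\<^sup>2
       + (2 * s - a) * \<beta> / \<rho> * (x $ i * A i) + \<alpha> / \<rho> + \<beta> * (A i)\<^sup>2 - \<beta> * Q i)" for i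
  proof -
    let ?B = "s * (x $ i / \<rho>) + A i"
    have "4 * (p - 1) / p = p * \<beta>" using p by (simp add: \<beta>_def power2_eq_square)
    then have q: "p * \<beta> * \<psi> * g i * ?B - \<kappa> * (g i)\<^sup>2 \<le> \<beta> * \<theta> * ?B\<^sup>2"
      using quadratic_absorption[OF p \<theta>, of "g i" ?B] by (simp only: \<beta>_def)
    have pa: "p * \<alpha> = p * \<beta> * s - a" using p by (simp add: \<alpha>_def algebra_simps)
    have "p * drift p a i x + a * (x $ i / \<rho>) = p * \<beta> * ?B"
      unfolding E using pa by algebra
    then have "- a * (x $ i / \<rho>) * (\<theta> * drift p a i x - \<psi> * g i)
      + p * \<psi> * g i * drift p a i x + \<theta> * drift_deriv p a i x - \<kappa> * (g i)\<^sup>2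
      = (p * \<beta> * \<psi> * g i * ?B - \<kappa> * (g i)\<^sup>2) + \<theta> * (drift_deriv p a i x - a * (x $ i / \<rho>) * drift p a i x)"
      by algebra
    also have "\<dots> \<le> \<beta> * \<theta> * ?B\<^sup>2 + \<theta> * (drift_deriv p a i x - a * (x $ i / \<rho>) * drift p a i x)"
      using q by simp
    also have "\<dots> = \<theta> * ((- a * \<alpha> - 2 * \<alpha> + \<beta> * s\<^sup>2) / \<rho>\<^sup>2 * (x $ i)\<^sup>2
       + (2 * s - a) * \<beta> / \<rho> * (x $ i * A i) + \<alpha> / \<rho> + \<beta> * (A i)\<^sup>2 - \<beta> * Q i)"
      unfolding E E' using \<rho> by (simp add: field_simps power2_eq_square)
    finally show ?thesis .
  qed
  have "(\<Sum>i\<in>UNIV. - a * (x $ i / \<rho>) * (\<theta> * drift p a i x - \<psi> * g i)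
      + p * \<psi> * g i * drift p a i x + \<theta> * drift_deriv p a i x - \<kappa> * (g i)\<^sup>2)
    \<le> (\<Sum>i\<in>UNIV. \<theta> * ((- a * \<alpha> - 2 * \<alpha> + \<beta> * s\<^sup>2) / \<rho>\<^sup>2 * (x $ i)\<^sup>2
       + (2 * s - a) * \<beta> / \<rho> * (x $ i * A i) + \<alpha> / \<rho> + \<beta> * (A i)\<^sup>2 - \<beta> * Q i))"
    by (rule sum_mono) (rule termwise)
  also have "\<dots> = \<theta> * ((- a * \<alpha> - 2 * \<alpha> + \<beta> * s\<^sup>2) / \<rho>\<^sup>2 * \<rho>
       + (2 * s - a) * \<beta> / \<rho> * (d * (d - 1) / 2) + d * (\<alpha> / \<rho>) + \<beta> * (\<Sum>i\<in>UNIV. Q i) - \<beta> * (\<Sum>i\<in>UNIV. Q i))"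
    by (simp only: sum_distrib_left[symmetric] sum.distrib sum_subtractf sx sxA sA sum_constant d_def)
  also have "\<dots> = (- a * \<alpha> - 2 * \<alpha> + \<beta> * s\<^sup>2 + (2 * s - a) * \<beta> * (d * (d - 1) / 2) + d * \<alpha>) * (\<theta> / \<rho>)"
    using \<rho> by (simp add: field_simps power2_eq_square)
  also have "- a * \<alpha> - 2 * \<alpha> + \<beta> * s\<^sup>2 + (2 * s - a) * \<beta> * (d * (d - 1) / 2) + d * \<alpha> = - (rellich_N d p \<gamma> / p\<^sup>2)"
  proof -
    have a2: "\<gamma> = a + 2 - 2 * p" by (simp add: a_def)
    have b2: "\<beta> * p\<^sup>2 = 4 * (p - 1)" "\<alpha> * p\<^sup>2 = \<beta> * p\<^sup>2 * s - a * p"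
      using p by (simp_all add: \<beta>_def \<alpha>_def power2_eq_square field_simps)
    have s2: "2 * s = - (d\<^sup>2 - 2 - a)" by (simp add: s_def)
    have "(- a * \<alpha> - 2 * \<alpha> + \<beta> * s\<^sup>2 + (2 * s - a) * \<beta> * (d * (d - 1) / 2) + d * \<alpha>) * p\<^sup>2
       = (d - 2 - a) * (\<alpha> * p\<^sup>2) + (\<beta> * p\<^sup>2) * (s\<^sup>2 + (2 * s - a) * (d * (d - 1) / 2))"
      by (simp add: field_simps)
    also have "\<dots> = (d - 2 - a) * (4 * (p - 1) * s - a * p) + 4 * (p - 1) * (s\<^sup>2 + (2 * s - a) * (d * (d - 1) / 2))"
      by (simp only: b2)
    also have "\<dots> = - rellich_N d p \<gamma>"
      unfolding rellich_N_def a2 s_def by (simp add: field_simps power2_eq_square)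
    finally show ?thesis using p by (simp add: field_simps)
  qed
  finally show ?thesis by (simp add: \<rho>_def d_def)
qed

section \<open>Regularity and the support\<close>

lemma continuous_extend_by_zero:
  fixes f :: "'a::topological_space \<Rightarrow> 'b::{zero,topological_space}"
  assumes "open S" "closed K" "K \<subseteq> S" "continuous_on S f" "\<And>x. x \<notin> K \<Longrightarrow> f x = 0"
  shows "continuous_on UNIV f"
proof -
  have "continuous_on (- K) f"
    by (rule continuous_on_eq[of _ "\<lambda>_. 0"]) (use assms in auto)
  then have "continuous_on (S \<union> - K) f"
    using assms by (intro continuous_on_open_Un) auto
  moreover have "S \<union> - K = UNIV" using assms by auto
  ultimately show ?thesis by simp
qed

lemma Ck2_compact_D:
  fixes u :: "real^'n \<Rightarrow> real"
  assumes u: "u \<in> Ck_compact 2 (UNIV - {0})"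
  defines "K \<equiv> closure {x. u x \<noteq> 0}"
  shows "compact K" and "K \<subseteq> UNIV - {0}" and "\<And>x. x \<notin> K \<Longrightarrow> u x = 0"
    and "\<And>x i. x \<notin> K \<Longrightarrow> partial i u x = 0"
    and "\<And>x i j. x \<notin> K \<Longrightarrow> partial j (partial i u) x = 0"
    and "continuous_on UNIV u" and "\<And>i. continuous_on UNIV (partial i u)"
    and "\<And>i j. continuous_on UNIV (partial j (partial i u))"
    and "\<And>x. x \<noteq> 0 \<Longrightarrow> u differentiable (at x)"
    and "\<And>x i. x \<noteq> 0 \<Longrightarrow> partial i u differentiable (at x)"
proof -
  have S: "open (UNIV - {0::real^'n})" by auto
  show K: "compact K" "K \<subseteq> UNIV - {0}" using u by (auto simp: Ck_compact_def K_def)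
  have cK: "closed K" by (simp add: K_def)
  have oK: "open (- K)" using cK by auto
  show 0: "\<And>x. x \<notin> K \<Longrightarrow> u x = 0" using closure_subset[of "{x. u x \<noteq> 0}"] by (auto simp: K_def)
  show 1: "\<And>x i. x \<notin> K \<Longrightarrow> partial i u x = 0" by (rule partial_locally_zero[OF oK]) (use 0 in auto)
  show 2: "\<And>x i j. x \<notin> K \<Longrightarrow> partial j (partial i u) x = 0" by (rule partial_locally_zero[OF oK]) (use 1 in auto)
  have C: "u differentiable_on (UNIV - {0})" "\<And>i. partial i u differentiable_on (UNIV - {0})"
      "\<And>i j. continuous_on (UNIV - {0}) (partial j (partial i u))"
    using u by (auto simp: Ck_compact_def numeral_2_eq_2)
  show "continuous_on UNIV u"
    by (rule continuous_extend_by_zero[OF S cK K(2)]) (use C 0 in \<open>auto intro: differentiable_imp_continuous_on\<close>)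
  show "continuous_on UNIV (partial i u)" for i
    by (rule continuous_extend_by_zero[OF S cK K(2)]) (use C 1 in \<open>auto intro: differentiable_imp_continuous_on\<close>)
  show "continuous_on UNIV (partial j (partial i u))" for i j
    by (rule continuous_extend_by_zero[OF S cK K(2)]) (use C 2 in auto)
  show "u differentiable (at x)" if "x \<noteq> 0" for x
    using C(1) that at_within_open[OF _ S, of x] by (metis DiffI UNIV_I differentiable_on_def singletonD)
  show "partial i u differentiable (at x)" if "x \<noteq> 0" for x i
    using C(2)[of i] that at_within_open[OF _ S, of x] by (metis DiffI UNIV_I differentiable_on_def singletonD)
qed

lemma antisymmetric_distinct_coords:
  assumes "antisymmetric u" "u x \<noteq> 0"
  shows "distinct_coords x"
  unfolding distinct_coords_def
proof (intro allI impI notI)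
  fix i j assume ij: "i \<noteq> j" "x $ i = x $ j"
  have "swap_coords i j x = x"
    using ij(2) by (auto simp: swap_coords_def vec_eq_iff Transposition.transpose_def)
  then have "u x = - u x" using assms(1) ij(1) unfolding antisymmetric_def by metis
  then show False using assms(2) by simp
qed

lemma open_distinct_coords: "open {x :: real^'n. distinct_coords x}"
proof -
  have "{x :: real^'n. distinct_coords x} = (\<Inter>i. \<Inter>j\<in>UNIV - {i}. {x. x $ i \<noteq> x $ j})"
    by (auto simp: distinct_coords_def)
  also have "open \<dots>"
    by (intro open_INT ballI finite finite_Diff open_Collect_neq continuous_intros)
  finally show ?thesis .
qed

lemma continuous_on_drift:
  assumes "\<And>x. x \<in> S \<Longrightarrow> distinct_coords x \<and> x \<noteq> 0"
  shows "continuous_on S (drift p a i)" and "continuous_on S (drift_deriv p a i)"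
proof -
  have nz: "x \<bullet> x \<noteq> 0" if "x \<in> S" for x using assms[OF that] by simp
  have A: "continuous_on S (\<lambda>x. 1 / (x $ i - x $ j))" for j
  proof (cases "i = j")
    case False
    then have "x $ i - x $ j \<noteq> 0" if "x \<in> S" for x
      using assms[OF that] by (auto simp: distinct_coords_def)
    then show ?thesis by (intro continuous_on_divide continuous_intros) blast+
  qed simp
  have A2: "continuous_on S (\<lambda>x. 1 / (x $ i - x $ j)\<^sup>2)" for j
    using continuous_on_power[OF A[of j], of 2] by (simp add: power_divide)
  have B: "continuous_on S (\<lambda>x. x $ i / (x \<bullet> x))" "continuous_on S (\<lambda>x. 1 / (x \<bullet> x))"
    using nz by (intro continuous_on_divide continuous_intros; blast)+
  have B2: "continuous_on S (\<lambda>x. 2 * (x $ i)\<^sup>2 / (x \<bullet> x)\<^sup>2)"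
    using nz by (intro continuous_on_divide continuous_intros) simp
  show "continuous_on S (drift p a i)"
    unfolding drift_def repulsion_def
    by (intro continuous_on_add continuous_on_mult continuous_on_const continuous_on_sum A B)
  show "continuous_on S (drift_deriv p a i)"
    unfolding drift_deriv_def
    by (intro continuous_on_diff continuous_on_mult continuous_on_const continuous_on_sum A2 B B2)
qed

section \<open>The integrated inequality\<close>

text \<open>
  Integration of \<open>divergence_bound\<close>, with the truncated powers of \<open>u\<close> for \<open>\<theta>\<close>, \<open>\<psi>\<close> and \<open>\<kappa>\<close>. Because
  \<open>u\<close> vanishes at the origin and wherever two coordinates coincide, the closed set \<open>|u| \<ge> \<epsilon>\<close> is a
  compact subset of the region where the drift is smooth; the flux is zero outside this set, so it is
  admissible in \<open>integral_directional_derivative_eq_0\<close>.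
\<close>

lemma truncated_energy_inequality:
  fixes u :: "real^'n \<Rightarrow> real" and p \<gamma> \<epsilon> :: real
  assumes p: "p > 1" and e: "\<epsilon> > 0"
    and u: "u \<in> Ck_compact 2 (UNIV - {0})" and anti: "antisymmetric u"
  defines "a \<equiv> \<gamma> + 2 * p - 2"
  defines "L \<equiv> \<lambda>x. truncation p \<epsilon> (u x) * (x \<bullet> x) powr (- a / 2) / (x \<bullet> x)"
    and "R \<equiv> \<lambda>x. - truncation' p \<epsilon> (u x) * laplacian u x * (x \<bullet> x) powr (- a / 2)"
  shows "integrable lborel L" and "integrable lborel R"
    and "rellich_N (real CARD('n)) p \<gamma> / p\<^sup>2 * integral\<^sup>L lborel L \<le> integral\<^sup>L lborel R"
proof -
  note U = Ck2_compact_D[OF u]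
  define \<Theta> \<psi> \<kappa> where "\<Theta> = truncation p \<epsilon>" and "\<psi> = truncation' p \<epsilon>" and "\<kappa> = truncation'' p \<epsilon>"
  define K where "K = {x. \<epsilon> \<le> \<bar>u x\<bar>}"
  define \<Omega> where "\<Omega> = {x::real^'n. distinct_coords x} \<inter> {x. x \<noteq> 0}"
  define W where "W x = (x \<bullet> x) powr (- a / 2)" for x :: "real^'n"
  have \<Omega>: "open \<Omega>" "\<And>x. x \<in> \<Omega> \<Longrightarrow> distinct_coords x \<and> x \<noteq> 0"
    unfolding \<Omega>_def by (intro open_Int open_distinct_coords open_Collect_neq continuous_intros) auto
  have clK: "closed K"
    unfolding K_def using U(6) by (intro closed_Collect_le continuous_intros) auto
  have Ksub: "K \<subseteq> closure {x. u x \<noteq> 0}"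
    by (rule order_trans[OF _ closure_subset]) (use e in \<open>auto simp: K_def\<close>)
  have cK: "compact K" using compact_Int_closed[OF U(1) clK] Ksub by (simp add: Int_absorb1)
  have K\<Omega>: "K \<subseteq> \<Omega>"
  proof
    fix x assume "x \<in> K"
    then show "x \<in> \<Omega>"
      using Ksub U(2) antisymmetric_distinct_coords[OF anti, of x] e by (auto simp: K_def \<Omega>_def)
  qed
  have out: "\<Theta> (u x) = 0" "\<psi> (u x) = 0" "\<kappa> (u x) = 0" if "x \<notin> K" for x
    using that truncation_eq_0[OF p, of "u x" \<epsilon>] by (auto simp: K_def \<Theta>_def \<psi>_def \<kappa>_def)
  have cont: "continuous_on S (\<lambda>x. \<Theta> (u x))" "continuous_on S (\<lambda>x. \<psi> (u x))" "continuous_on S (\<lambda>x. \<kappa> (u x))" for S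
    unfolding \<Theta>_def \<psi>_def \<kappa>_def
    using continuous_truncation[OF p e] U(6)
    by (auto intro: continuous_on_compose2 continuous_on_subset)
  have cpart: "continuous_on S (partial i u)" "continuous_on S (partial i (partial i u))" for S i
    using U(7,8) by (auto intro: continuous_on_subset)
  have nz: "x \<bullet> x \<noteq> 0" if "x \<in> \<Omega>" for x using \<Omega>(2)[OF that] by simp
  have cW: "continuous_on \<Omega> W"
    unfolding W_def using nz by (intro continuous_on_powr continuous_intros) auto
  have cx: "continuous_on \<Omega> (\<lambda>x. x $ i / (x \<bullet> x))" "continuous_on \<Omega> (\<lambda>x. 1 / (x \<bullet> x))" for i
    using nz by (intro continuous_on_divide continuous_intros; blast)+
  note cD = continuous_on_drift[OF \<Omega>(2)]

  \<comment> \<open>\<open>F\<close> is the flux and the sum of the \<open>G i\<close> its divergence; \<open>H i\<close> collects the terms without second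
    derivatives of \<open>u\<close>.\<close>
  define F where "F i x = W x * (\<Theta> (u x) * drift p a i x - \<psi> (u x) * partial i u x)" for i x
  define H where "H i x = - a * (x $ i / (x \<bullet> x)) * (\<Theta> (u x) * drift p a i x - \<psi> (u x) * partial i u x)
      + p * \<psi> (u x) * partial i u x * drift p a i x + \<Theta> (u x) * drift_deriv p a i x
      - \<kappa> (u x) * (partial i u x)\<^sup>2" for i x
  define G where "G i x = W x * (H i x - \<psi> (u x) * partial i (partial i u) x)" for i x
  have F0: "F i x = 0" and G0: "G i x = 0" if "x \<notin> K" for i x
    using out[OF that] by (auto simp: F_def G_def H_def)
  have cF: "continuous_on UNIV (F i)" for i
    by (rule continuous_extend_by_zero[OF \<Omega>(1) clK K\<Omega> _ F0])
      (auto simp: F_def intro!: continuous_on_mult continuous_on_diff cW cD cont cpart)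
  have cG: "continuous_on UNIV (G i)" for i
    by (rule continuous_extend_by_zero[OF \<Omega>(1) clK K\<Omega> _ G0])
      (auto simp: G_def H_def simp del: times_divide_eq_right mult_minus_left
        intro!: continuous_on_mult continuous_on_diff continuous_on_add continuous_on_power
          continuous_on_const cW cD cont cpart cx)
  have der: "((\<lambda>t. F i (x + t *\<^sub>R axis i 1)) has_real_derivative G i x) (at 0)" for i x
  proof (cases "x \<in> K")
    case False
    have "open ((\<lambda>t::real. x + t *\<^sub>R axis i 1) -` (- K))"
      using clK by (intro open_vimage continuous_intros) auto
    then have "((\<lambda>t. F i (x + t *\<^sub>R axis i 1)) has_real_derivative 0) (at 0)"
      by (rule has_field_derivative_transform_within_open[of "\<lambda>_. 0", rotated])
        (use False F0 in auto)
    then show ?thesis using G0[OF False] by simp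
  next
    case True
    then have x: "distinct_coords x" "x \<noteq> 0" using K\<Omega> \<Omega>(2) by auto
    have dW: "((\<lambda>t. W (x + t *\<^sub>R axis i 1)) has_real_derivative - a * (x $ i / (x \<bullet> x)) * W x) (at 0)"
      using DERIV_radial_weight[OF x(2), of i "- a / 2"] by (simp add: W_def)
    have du: "((\<lambda>t. u (x + t *\<^sub>R axis i 1)) has_real_derivative partial i u x) (at 0)"
      using DERIV_partial[OF U(9)[OF x(2)]] .
    have dp: "((\<lambda>t. partial i u (x + t *\<^sub>R axis i 1)) has_real_derivative partial i (partial i u) x) (at 0)"
      using DERIV_partial[OF U(10)[OF x(2)]] .
    have d\<Theta>: "((\<lambda>t. \<Theta> (u (x + t *\<^sub>R axis i 1))) has_real_derivative p * \<psi> (u x) * partial i u x) (at 0)"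
      using DERIV_chain2[OF _ du, of \<Theta>] DERIV_truncation(1)[OF p e] by (simp add: \<Theta>_def \<psi>_def)
    have d\<psi>: "((\<lambda>t. \<psi> (u (x + t *\<^sub>R axis i 1))) has_real_derivative \<kappa> (u x) * partial i u x) (at 0)"
      using DERIV_chain2[OF _ du, of \<psi>] DERIV_truncation(2)[OF p e] by (simp add: \<kappa>_def \<psi>_def)
    have "((\<lambda>t. F i (x + t *\<^sub>R axis i 1)) has_real_derivative
        - a * (x $ i / (x \<bullet> x)) * W x * (\<Theta> (u x) * drift p a i x - \<psi> (u x) * partial i u x)
        + (p * \<psi> (u x) * partial i u x * drift p a i x + drift_deriv p a i x * \<Theta> (u x)
            - (\<kappa> (u x) * partial i u x * partial i u x + partial i (partial i u) x * \<psi> (u x))) * W x) (at 0)"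
      using DERIV_mult[OF dW DERIV_diff[OF DERIV_mult[OF d\<Theta> DERIV_drift[OF x, of p a i]] DERIV_mult[OF d\<psi> dp]]]
      unfolding F_def by simp
    moreover have "- a * (x $ i / (x \<bullet> x)) * W x * (\<Theta> (u x) * drift p a i x - \<psi> (u x) * partial i u x)
        + (p * \<psi> (u x) * partial i u x * drift p a i x + drift_deriv p a i x * \<Theta> (u x)
            - (\<kappa> (u x) * partial i u x * partial i u x + partial i (partial i u) x * \<psi> (u x))) * W x = G i x"
      unfolding G_def H_def by algebra
    ultimately show ?thesis by simp
  qed
  have intG: "integrable lborel (G i)" "integral\<^sup>L lborel (G i) = 0" for i
    using compact_support_integrable[OF cK cG G0]
      integral_directional_derivative_eq_0[OF cK F0 G0 cF cG der] by auto

  have L0: "L x = 0" and R0: "R x = 0" if "x \<notin> K" for x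
    using out[OF that] by (auto simp: L_def R_def \<Theta>_def \<psi>_def)
  have Leq: "L = (\<lambda>x. \<Theta> (u x) * W x * (1 / (x \<bullet> x)))" by (simp add: L_def \<Theta>_def W_def)
  have Req: "R = (\<lambda>x. - (\<psi> (u x) * laplacian u x * W x))" by (simp add: R_def \<psi>_def W_def)
  have "continuous_on UNIV L"
    by (rule continuous_extend_by_zero[OF \<Omega>(1) clK K\<Omega> _ L0])
      (unfold Leq, intro continuous_on_mult cont cW cx)
  from compact_support_integrable[OF cK this L0] show iL: "integrable lborel L" .
  have "continuous_on UNIV R"
    by (rule continuous_extend_by_zero[OF \<Omega>(1) clK K\<Omega> _ R0])
      (unfold Req laplacian_def, intro continuous_on_minus continuous_on_mult continuous_on_sum cont cW cpart)
  from compact_support_integrable[OF cK this R0] show iR: "integrable lborel R" .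

  let ?c = "rellich_N (real CARD('n)) p \<gamma> / p\<^sup>2"
  have ptw: "?c * L x + (\<Sum>i\<in>UNIV. G i x) \<le> R x" for x
  proof (cases "x \<in> K")
    case False
    then show ?thesis using L0 R0 G0 by simp
  next
    case True
    then have x: "distinct_coords x" "x \<noteq> 0" using K\<Omega> \<Omega>(2) by auto
    have "(\<Sum>i\<in>UNIV. H i x) \<le> - ?c * (\<Theta> (u x) / (x \<bullet> x))"
      unfolding H_def \<Theta>_def \<psi>_def \<kappa>_def a_def
      by (rule divergence_bound[OF x p]) (use truncation_ineqs[OF p e] in auto)
    then have "W x * (\<Sum>i\<in>UNIV. H i x) \<le> W x * (- ?c * (\<Theta> (u x) / (x \<bullet> x)))"
      by (intro mult_left_mono) (auto simp: W_def)
    moreover have "(\<Sum>i\<in>UNIV. G i x) = W x * (\<Sum>i\<in>UNIV. H i x) + R x"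
      unfolding G_def Req laplacian_def
      by (simp add: sum_subtractf sum_distrib_left right_diff_distrib mult_ac)
    ultimately show ?thesis by (simp add: Leq algebra_simps)
  qed
  have "?c * integral\<^sup>L lborel L = (\<integral>x. ?c * L x + (\<Sum>i\<in>UNIV. G i x) \<partial>lborel)"
    using iL intG by (simp add: Bochner_Integration.integral_sum)
  also have "\<dots> \<le> integral\<^sup>L lborel R"
    by (rule integral_mono) (use iL iR intG ptw in auto)
  finally show "?c * integral\<^sup>L lborel L \<le> integral\<^sup>L lborel R" .
qed

lemma inner_self_powr: "(x \<bullet> x) powr b = norm x powr (2 * b)" for x :: "'a::real_inner"
  by (cases "x = 0") (simp_all add: dot_square_norm powr_powr flip: powr_numeral)

text \<open>
  Young's inequality for \<open>X r^(-\<gamma>/p)\<close> and \<open>(c \<theta>^(1/p) r^(-(\<gamma>+2p)/p))^(p-1)\<close>: the exponents of \<open>r\<close> add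
  up to \<open>- (\<gamma> + 2p - 2)\<close>. The powers of \<open>c\<close> are chosen so that, when the energy inequality bounds the
  left-hand side from below by \<open>c^p\<close> times an integral, the last term can be absorbed.
\<close>

lemma Youngs_inequality_weighted:
  fixes p \<gamma> \<psi> \<theta> X r c :: real
  assumes p: "p > 1" and "X \<ge> 0" "\<theta> \<ge> 0" "c \<ge> 0" "r > 0" and \<psi>: "\<bar>\<psi>\<bar> \<le> \<theta> powr ((p - 1) / p)"
  shows "c powr (p - 1) * (\<bar>\<psi>\<bar> * X * r powr (- (\<gamma> + 2 * p - 2)))
    \<le> (1 / p) * (X powr p / r powr \<gamma>) + (1 - 1 / p) * (c powr p * (\<theta> / r powr (\<gamma> + 2 * p)))"
proof -
  define A where "A = X * r powr (- \<gamma> / p)"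
  define B where "B = (c powr p * \<theta> * r powr (- (\<gamma> + 2 * p))) powr ((p - 1) / p)"
  have q: "p / (p - 1) > 1" "1 / p + 1 / (p / (p - 1)) = 1" using p by (auto simp: field_simps)
  have B: "B = c powr (p - 1) * \<theta> powr ((p - 1) / p) * r powr (- (\<gamma> + 2 * p) * ((p - 1) / p))"
    using assms by (simp add: B_def powr_mult powr_powr del: times_divide_eq_right) simp
  have e: "- \<gamma> / p + - (\<gamma> + 2 * p) * ((p - 1) / p) = - (\<gamma> + 2 * p - 2)"
    using p by (simp add: field_simps)
  have "c powr (p - 1) * (\<bar>\<psi>\<bar> * X * r powr (- (\<gamma> + 2 * p - 2)))
      \<le> c powr (p - 1) * (\<theta> powr ((p - 1) / p) * X * r powr (- (\<gamma> + 2 * p - 2)))"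
    using assms by (intro mult_left_mono mult_right_mono) auto
  also have "\<dots> = A * B"
    unfolding A_def B e[symmetric] powr_add by (simp only: mult_ac)
  also have "\<dots> \<le> A powr p / p + B powr (p / (p - 1)) / (p / (p - 1))"
    by (rule Youngs_inequality[OF p q]) (use assms in \<open>auto simp: A_def B_def\<close>)
  also have "A powr p = X powr p / r powr \<gamma>"
  proof -
    have "- \<gamma> / p * p = - \<gamma>" using p by simp
    then have "A powr p = X powr p * r powr (- \<gamma>)"
      using assms by (simp only: A_def powr_mult powr_powr powr_ge_zero)
    then show ?thesis by (simp add: powr_minus_divide)
  qed
  also have "B powr (p / (p - 1)) = c powr p * (\<theta> / r powr (\<gamma> + 2 * p))"
  proof -
    have "(p - 1) / p * (p / (p - 1)) = 1" using p by simp
    then have "B powr (p / (p - 1)) = c powr p * \<theta> * r powr (- (\<gamma> + 2 * p))"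
      using assms by (simp only: B_def powr_powr) simp
    then show ?thesis by (simp only: powr_minus_divide times_divide_eq_right mult_1_right)
  qed
  finally show ?thesis using p by (simp add: field_simps)
qed

section \<open>The Rellich inequality\<close>

theorem theorem6:
  fixes u :: "real^'n \<Rightarrow> real" and p \<gamma> :: real
  assumes "p > 1"
    and "CARD('n) \<ge> 2"
    and "u \<in> Ck_compact 2 (UNIV - {0})"
    and "antisymmetric u"
    and "rellich_N (real CARD('n)) p \<gamma> \<ge> 0"
  shows "(\<integral>x. \<bar>laplacian u x\<bar> powr p / norm x powr \<gamma> \<partial>lborel)
    \<ge> rellich_const (real CARD('n)) p \<gamma> * (\<integral>x. \<bar>u x\<bar> powr p / norm x powr (\<gamma> + 2*p) \<partial>lborel)"
proof -
  note p = assms(1) and U = Ck2_compact_D[OF assms(3)]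
  define c where "c = rellich_N (real CARD('n)) p \<gamma> / p\<^sup>2"
  define w where "w x = \<bar>u x\<bar> powr p / norm x powr (\<gamma> + 2*p)" for x
  define v where "v x = \<bar>laplacian u x\<bar> powr p / norm x powr \<gamma>" for x
  define w\<epsilon> where "w\<epsilon> \<epsilon> x = truncation p \<epsilon> (u x) / norm x powr (\<gamma> + 2*p)" for \<epsilon> x
  define a where "a = \<gamma> + 2 * p - 2"
  have c: "c \<ge> 0" using assms(5) by (simp add: c_def)
  have S: "open (UNIV - {0::real^'n})" by auto
  have cK: "closed (closure {x. u x \<noteq> 0})" by simp
  have lap: "continuous_on UNIV (laplacian u)"
    unfolding laplacian_def[abs_def] by (intro continuous_on_sum U(8))
  have lap0: "laplacian u x = 0" if "x \<notin> closure {x. u x \<noteq> 0}" for x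
    using U(5)[OF that] by (simp add: laplacian_def)
  have pw: "continuous_on (UNIV - {0}) (\<lambda>x. \<bar>f x\<bar> powr p / norm x powr b)"
    if "continuous_on UNIV f" for f :: "real^'n \<Rightarrow> real" and b
    using continuous_on_subset[OF that] p by (intro continuous_on_divide continuous_on_powr' continuous_intros) auto
  have int: "integrable lborel (\<lambda>x. \<bar>f x\<bar> powr p / norm x powr b)"
    if "continuous_on UNIV f" "\<And>x. x \<notin> closure {x. u x \<noteq> 0} \<Longrightarrow> f x = 0" for f :: "real^'n \<Rightarrow> real" and b
  proof -
    have 0: "\<bar>f x\<bar> powr p / norm x powr b = 0" if "x \<notin> closure {x. u x \<noteq> 0}" for x
      using that \<open>\<And>x. x \<notin> closure {x. u x \<noteq> 0} \<Longrightarrow> f x = 0\<close> by simp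
    show ?thesis
      by (rule compact_support_integrable[OF U(1) continuous_extend_by_zero[OF S cK U(2) pw[OF that(1)] 0] 0])
  qed
  have iw: "integrable lborel w" unfolding w_def by (rule int[OF U(6) U(3)])
  have iv: "integrable lborel v" unfolding v_def by (rule int[OF lap lap0])
  have trunc: "c powr p * integral\<^sup>L lborel (w\<epsilon> \<epsilon>) \<le> integral\<^sup>L lborel v" and iwe: "integrable lborel (w\<epsilon> \<epsilon>)"
    if e: "\<epsilon> > 0" for \<epsilon>
  proof -
    let ?R = "\<lambda>x. - truncation' p \<epsilon> (u x) * laplacian u x * (x \<bullet> x) powr (- a / 2)"
    have L: "w\<epsilon> \<epsilon> = (\<lambda>x. truncation p \<epsilon> (u x) * (x \<bullet> x) powr (- a / 2) / (x \<bullet> x))"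
    proof
      fix x
      show "w\<epsilon> \<epsilon> x = truncation p \<epsilon> (u x) * (x \<bullet> x) powr (- a / 2) / (x \<bullet> x)"
      proof (cases "x = 0")
        case False
        have "(x \<bullet> x) powr (- a / 2) / (x \<bullet> x) = norm x powr (- a - 2)"
          using False unfolding inner_self_powr by (simp add: powr_diff dot_square_norm)
        moreover have "- a - 2 = - (\<gamma> + 2 * p)" by (simp add: a_def)
        ultimately have "(x \<bullet> x) powr (- a / 2) / (x \<bullet> x) = norm x powr (- (\<gamma> + 2 * p))" by simp
        then show ?thesis by (simp only: w\<epsilon>_def powr_minus_divide times_divide_eq_right[symmetric]) simp
      qed (simp add: w\<epsilon>_def)
    qed
    note E = truncated_energy_inequality[OF p e assms(3,4), of \<gamma>, folded a_def, folded L c_def]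
    show "integrable lborel (w\<epsilon> \<epsilon>)" by (rule E)
    have "c powr (p - 1) * ?R x \<le> (1 / p) * v x + (1 - 1 / p) * (c powr p * w\<epsilon> \<epsilon> x)" for x
    proof (cases "x = 0")
      case True
      then show ?thesis by (simp add: v_def w\<epsilon>_def)
    next
      case False
      have "?R x \<le> \<bar>truncation' p \<epsilon> (u x)\<bar> * \<bar>laplacian u x\<bar> * norm x powr (- a)"
      proof -
        have "- truncation' p \<epsilon> (u x) * laplacian u x \<le> \<bar>truncation' p \<epsilon> (u x)\<bar> * \<bar>laplacian u x\<bar>"
          by (metis abs_ge_minus_self abs_mult mult_minus_left)
        moreover have "2 * (- a / 2) = - a" by simp
        ultimately show ?thesis by (simp only: inner_self_powr) (rule mult_right_mono, auto)
      qed
      then have "c powr (p - 1) * ?R x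
          \<le> c powr (p - 1) * (\<bar>truncation' p \<epsilon> (u x)\<bar> * \<bar>laplacian u x\<bar> * norm x powr (- a))"
        by (intro mult_left_mono) auto
      also have "\<dots> \<le> (1 / p) * v x + (1 - 1 / p) * (c powr p * w\<epsilon> \<epsilon> x)"
        unfolding v_def w\<epsilon>_def a_def
        by (rule Youngs_inequality_weighted[OF p]) (use c False truncation_ineqs[OF p e] in auto)
      finally show ?thesis .
    qed
    then have "(\<integral>x. c powr (p - 1) * ?R x \<partial>lborel)
        \<le> (\<integral>x. (1 / p) * v x + (1 - 1 / p) * (c powr p * w\<epsilon> \<epsilon> x) \<partial>lborel)"
      using E(1,2) iv by (intro integral_mono) (auto simp del: mult_minus_left)
    also have "\<dots> = (1 / p) * integral\<^sup>L lborel v + (1 - 1 / p) * (c powr p * integral\<^sup>L lborel (w\<epsilon> \<epsilon>))"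
      using E(1) iv by simp
    finally have up: "c powr (p - 1) * integral\<^sup>L lborel ?R
      \<le> (1 / p) * integral\<^sup>L lborel v + (1 - 1 / p) * (c powr p * integral\<^sup>L lborel (w\<epsilon> \<epsilon>))"
      by (simp only: integral_mult_right_zero)
    have "c powr p = c powr (p - 1) * c" using c powr_mult_base[of c "p - 1"] by (simp add: mult.commute)
    then have "c powr p * integral\<^sup>L lborel (w\<epsilon> \<epsilon>) \<le> c powr (p - 1) * integral\<^sup>L lborel ?R"
      using E(3) by (simp only: mult.assoc) (intro mult_left_mono, auto)
    \<comment> \<open>The last term on the right is absorbed into the left-hand side.\<close>
    with up have "c powr p * integral\<^sup>L lborel (w\<epsilon> \<epsilon>)
      \<le> (1 / p) * integral\<^sup>L lborel v + (1 - 1 / p) * (c powr p * integral\<^sup>L lborel (w\<epsilon> \<epsilon>))" by linarith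
    then have "(1 / p) * (c powr p * integral\<^sup>L lborel (w\<epsilon> \<epsilon>)) \<le> (1 / p) * integral\<^sup>L lborel v"
      by (simp only: left_diff_distrib)
    then show "c powr p * integral\<^sup>L lborel (w\<epsilon> \<epsilon>) \<le> integral\<^sup>L lborel v"
      using p by (simp add: divide_le_cancel)
  qed
  define \<tau> where "\<tau> n = inverse (real (Suc n))" for n
  have \<tau>: "\<tau> n > 0" "\<tau> \<longlonglongrightarrow> 0" for n
    unfolding \<tau>_def using LIMSEQ_inverse_real_of_nat by auto
  have "(\<lambda>n. integral\<^sup>L lborel (w\<epsilon> (\<tau> n))) \<longlonglongrightarrow> integral\<^sup>L lborel w"
  proof (rule integral_dominated_convergence[where w = w])
    show "AE x in lborel. (\<lambda>n. w\<epsilon> (\<tau> n) x) \<longlonglongrightarrow> w x"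
      unfolding w\<epsilon>_def w_def divide_inverse
      by (intro always_eventually allI tendsto_mult_right truncation_tendsto p \<tau>)
    show "AE x in lborel. norm (w\<epsilon> (\<tau> n) x) \<le> w x" for n
      unfolding w\<epsilon>_def w_def using truncation_ineqs(1,2)[OF p \<tau>(1)]
      by (intro always_eventually allI) (auto simp: intro!: divide_right_mono)
  qed (use iw iwe \<tau> in auto)
  then have "(\<lambda>n. c powr p * integral\<^sup>L lborel (w\<epsilon> (\<tau> n))) \<longlonglongrightarrow> c powr p * integral\<^sup>L lborel w"
    by (rule tendsto_mult_left)
  then have "c powr p * integral\<^sup>L lborel w \<le> integral\<^sup>L lborel v"
    by (rule LIMSEQ_le_const2) (use trunc \<tau> in auto)
  then show ?thesis by (simp add: rellich_const_def c_def w_def[abs_def] v_def[abs_def])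
qed

end
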